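(* For any positive integers $M$ and $k$ and any Boolean function $f:\{0,1,\dots,N-1\}\to\{0,1\}$ with $t=|f^{-1}(1)|$, the algorithm $\mathbf{Count}(f,M)$ outputs an estimate $t'$ such that $$|t'-t|\le 2\pi k\frac{\sqrt{t(N-t)}}{M}+\pi^2k^2\frac{N}{M^2}$$ with probability at least $8/\pi^2$ when $k=1$, and with probability greater than $1-\frac{1}{2(k-1)}$ when $k\ge2$. If $t=0$ then $t'=0$ with certainty, and if $t=N$ and $M$ is even then $t'=N$ with certainty.
   Context: For $M\ge1$, $\mathbf F_M|x\rangle=\frac{1}{\sqrt M}\sum_{y=0}^{M-1}e^{2\pi ixy/M}|y\rangle$. For a unitary $\mathbf U$, $\Lambda_M(\mathbf U)$ is $|j\rangle|y\rangle\mapsto|j\rangle(\mathbf U^j|y\rangle)$, $0\le j<M$. Take $\mathcal H$ with basis $|0\rangle,\dots,|N-1\rangle$, $\mathcal A=\mathbf F_N$, $\chi=f$, $\mathbf S_f|x\rangle=(-1)^{f(x)}|x\rangle$, $\mathbf S_0$ negating $|0\rangle$ and fixing other basis states, and $\mathbf Q=-\mathcal A\mathbf S_0\mathcal A^{-1}\mathbf S_f$. $\mathbf{Est\_Amp}(\mathcal A,f,M)$: prepare $|0\rangle\otimes\mathcal A|0\rangle$ (first register $M$-dimensional); apply $\mathbf F_M$ to the first register; apply $\Lambda_M(\mathbf Q)$; apply $\mathbf F_M^{-1}$ to the first register; measure the first register obtaining $y$; output $\sin^2(\pi y/M)$. Algorithm $\mathbf{Count}(f,M)$ outputs $t'=N\cdot\mathbf{Est\_Amp}(\mathbf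 F_N,f,M)$. *)

theory Defs
  imports Complex_Main
begin

text \<open>Vectors of a d-dimensional space with basis |0>,...,|d-1> are represented as
  functions nat => complex (only the entries below d are relevant).
  Two-register states are functions nat => nat => complex, psi j x being the
  amplitude of |j>|x>.\<close>

type_synonym cvec = "nat \<Rightarrow> complex"
type_synonym cvec2 = "nat \<Rightarrow> nat \<Rightarrow> complex"

definition QFT :: "nat \<Rightarrow> cvec \<Rightarrow> cvec" where
  "QFT M v = (\<lambda>y. \<Sum>x<M. exp (2 * of_real pi * \<i> * of_nat x * of_nat y / of_nat M)
                              / of_real (sqrt (real M)) * v x)"

text \<open>F_M^{-1} (= conjugate transpose of the unitary F_M).\<close>
definition IQFT :: "nat \<Rightarrow> cvec \<Rightarrow> cvec" where
  "IQFT M v = (\<lambda>y. \<Sum>x<M. exp (- (2 * of_real pi * \<i> * of_nat x * of_nat y / of_nat M))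
                              / of_real (sqrt (real M)) * v x)"

definition S_f :: "(nat \<Rightarrow> bool) \<Rightarrow> cvec \<Rightarrow> cvec" where
  "S_f f v = (\<lambda>x. if f x then - v x else v x)"

definition S_0 :: "cvec \<Rightarrow> cvec" where
  "S_0 v = (\<lambda>x. if x = 0 then - v x else v x)"

definition Q_op :: "nat \<Rightarrow> (nat \<Rightarrow> bool) \<Rightarrow> cvec \<Rightarrow> cvec" where
  "Q_op N f v = (\<lambda>x. - QFT N (S_0 (IQFT N (S_f f v))) x)"

definition Lambda :: "(cvec \<Rightarrow> cvec) \<Rightarrow> cvec2 \<Rightarrow> cvec2" where
  "Lambda U psi = (\<lambda>j. (U ^^ j) (psi j))"

definition on_first :: "(cvec \<Rightarrow> cvec) \<Rightarrow> cvec2 \<Rightarrow> cvec2" where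
  "on_first V psi = (\<lambda>j x. V (\<lambda>j'. psi j' x) j)"

definition ket0 :: cvec where "ket0 = (\<lambda>x. if x = 0 then 1 else 0)"

definition est_amp_state :: "nat \<Rightarrow> (nat \<Rightarrow> bool) \<Rightarrow> nat \<Rightarrow> cvec2" where
  "est_amp_state N f M =
     (let psi0 = (\<lambda>j. if j = 0 then QFT N ket0 else (\<lambda>_. 0));
          psi1 = on_first (QFT M) psi0;
          psi2 = Lambda (Q_op N f) psi1;
          psi3 = on_first (IQFT M) psi2
      in psi3)"

definition meas_prob :: "nat \<Rightarrow> (nat \<Rightarrow> bool) \<Rightarrow> nat \<Rightarrow> nat \<Rightarrow> real" where
  "meas_prob N f M y = (\<Sum>x<N. (cmod (est_amp_state N f M y x))\<^sup>2)"

definition count_output :: "nat \<Rightarrow> nat \<Rightarrow> nat \<Rightarrow> real" where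
  "count_output N M y = real N * (sin (pi * real y / real M))\<^sup>2"

definition count_prob :: "nat \<Rightarrow> (nat \<Rightarrow> bool) \<Rightarrow> nat \<Rightarrow> (real \<Rightarrow> bool) \<Rightarrow> real" where
  "count_prob N f M P = (\<Sum>y\<in>{y. y < M \<and> P (count_output N M y)}. meas_prob N f M y)"

end

theory Submission
  imports Defs "HOL-Analysis.Complex_Transcendental"
begin

text \<open>
  On the uniform superposition, \<open>Q\<close> acts as a rotation by \<open>2 \<theta>\<close> in the plane spanned by
  the marked and the unmarked basis states, where \<open>sin\<^sup>2 \<theta> = t / N\<close>. Hence the register
  measured by the algorithm is a phase estimation of the two eigenphases \<open>\<plusminus>\<omega> / M\<close>, with
  \<open>\<omega> = M \<theta> / \<pi>\<close>, and the distribution of \<open>y\<close> is the average of the Fejer kernels centred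
  at \<open>\<omega>\<close> and \<open>-\<omega>\<close>. The output does not distinguish \<open>y\<close> from \<open>M - y\<close>, so both kernels may
  be replaced by the first one. Outcomes at cyclic distance at most \<open>k\<close> from \<open>\<omega>\<close> give
  a good estimate. For \<open>k = 1\<close> the two outcomes next to \<open>\<omega>\<close> already carry probability
  \<open>8 / \<pi>\<^sup>2\<close>; for \<open>k \<ge> 2\<close> the kernel decays like \<open>1 / (4 x\<^sup>2)\<close>, and the tail on
  each side telescopes to less than \<open>1 / (4 (k - 1))\<close>.
\<close>


subsection \<open>Trigonometric inequalities\<close>

lemma sin_ge_diff_cube:
  fixes x :: real
  assumes "x \<ge> 0"
  shows "x - x ^ 3 / 6 \<le> sin x"
proof -
  have "(\<Sum>m<3. sin_coeff m * x ^ m) = x"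
    by (simp add: eval_nat_numeral sin_coeff_def)
  then show ?thesis
    using Maclaurin_sin_bound[of x 3] assms abs_ge_minus_self[of "sin x - x"]
    by (simp add: fact_numeral field_simps)
qed

lemma cos_ge_diff_square:
  fixes x :: real
  shows "1 - x\<^sup>2 / 2 \<le> cos x"
proof -
  have "\<bar>sin (x / 2)\<bar>\<^sup>2 \<le> \<bar>x / 2\<bar>\<^sup>2"
    by (intro power_mono abs_sin_x_le_abs_x) auto
  then show ?thesis
    using cos_double_sin[of "x / 2"] by (simp add: power_divide)
qed

text \<open>Jordan's inequality: \<open>sin (pi * u)\<close> is concave on [0, 1/2], so it lies
  above its chord from (0, 0) to (1/2, 1).\<close>

lemma sin_pi_ge_linear:
  fixes u :: real
  assumes "0 \<le> u" "u \<le> 1 / 2"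
  shows "2 * u \<le> sin (pi * u)"
proof -
  have "concave_on {0..1/2} (\<lambda>x. sin (pi * x))"
  proof (rule f''_le0_imp_concave)
    show "((\<lambda>x. sin (pi * x)) has_real_derivative pi * cos (pi * x)) (at x)" for x
      by (auto intro!: derivative_eq_intros)
    show "((\<lambda>x. pi * cos (pi * x)) has_real_derivative - (pi\<^sup>2 * sin (pi * x))) (at x)" for x
      by (auto intro!: derivative_eq_intros simp: power2_eq_square)
    fix x :: real assume x: "x \<in> {0..1/2}"
    then have "pi * x \<le> pi * 1"
      by (intro mult_left_mono) auto
    then show "- (pi\<^sup>2 * sin (pi * x)) \<le> 0"
      using x by (auto intro!: mult_nonneg_nonneg sin_ge_zero)
  qed auto
  from concave_onD_Icc'[OF this, of u] show ?thesis
    using assms by simp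
qed

lemma abs_sin_pi_ge_linear:
  fixes u :: real
  assumes "\<bar>u\<bar> \<le> 1 / 2"
  shows "2 * \<bar>u\<bar> \<le> \<bar>sin (pi * u)\<bar>"
proof (cases "u \<ge> 0")
  case True
  then show ?thesis using sin_pi_ge_linear[of u] assms by auto
next
  case False
  then show ?thesis using sin_pi_ge_linear[of "- u"] assms by auto
qed

text \<open>This is \<open>sin_pi_two_point_bound\<close> centred at the midpoint, with v = 1 - 2 d.
  Equality holds at v = 0 and at v = 1, so the estimates must be sharp at both ends.\<close>

lemma cos_half_pi_square_bound:
  fixes v :: real
  assumes "0 \<le> v" "v \<le> 1"
  shows "(1 - v\<^sup>2)\<^sup>2 \<le> (cos (pi * v / 2))\<^sup>2 * (1 + v\<^sup>2)"
proof (cases "v \<le> 3 / 5") \<comment> \<open>Both sides vanish at \<open>v = 1\<close>, so there the sine is expanded in \<open>1 - v\<close> instead.\<close>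
  case True
  define w where "w = v\<^sup>2"
  have w: "0 \<le> w" "w \<le> 9 / 25"
    using power_mono[OF True assms(1), of 2] by (auto simp: w_def power2_eq_square)
  have "pi\<^sup>2 \<le> (3.15::real)\<^sup>2"
    using pi_approx by (intro power_mono) auto
  then have "pi\<^sup>2 \<le> 10"
    by (simp add: power2_eq_square)
  then have "pi\<^sup>2 * w \<le> 10 * w"
    using w by (intro mult_right_mono)
  then have "1 - 5 / 4 * w \<le> cos (pi * v / 2)"
    using cos_ge_diff_square[of "pi * v / 2"] by (simp add: w_def power_mult_distrib power_divide)
  then have "(1 - 5 / 4 * w)\<^sup>2 * (1 + w) \<le> (cos (pi * v / 2))\<^sup>2 * (1 + w)"
    using w by (intro mult_right_mono power_mono) auto
  \<comment> \<open>The cofactor of w is 1/2 - 31/16 w + 25/16 w^2. Splitting off 1/200 leaves a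
    product whose factors are visibly nonnegative for w <= 9/25.\<close>
  moreover have "(1 - 5 / 4 * w)\<^sup>2 * (1 + w) - (1 - w)\<^sup>2 =
      w * ((9 / 25 - w) * (11 / 8 - 25 / 16 * w) + 1 / 200)"
    by (simp add: power2_eq_square algebra_simps add_divide_distrib diff_divide_distrib)
  moreover have "\<dots> \<ge> 0"
    using w by (intro mult_nonneg_nonneg add_nonneg_nonneg) auto
  ultimately show ?thesis
    by (simp add: w_def)
next
  case False
  define r x where "r = 1 - v" and "x = pi * r / 2"
  have r: "0 \<le> r" "r \<le> 2 / 5"
    using False assms by (auto simp: r_def)
  have x: "1.57 * r \<le> x" "x \<le> 1.58 * r"
    using pi_approx r mult_right_mono[of "1.57" "pi / 2" r] mult_right_mono[of "pi / 2" "1.58" r]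
    by (auto simp: x_def)
  have "x\<^sup>2 \<le> (1.58 * 2 / 5)\<^sup>2"
    using x r by (intro power_mono) auto
  then have x2: "x\<^sup>2 \<le> 0.4"
    by (simp add: power2_eq_square)
  \<comment> \<open>The constant lies below 1.57 * (1 - 0.4 / 6) and above sqrt 2, the least c
    allowed as r tends to 0, where the claim becomes 2 (c r)^2 >= (2 r)^2.\<close>
  have "1.46 * r \<le> (1.57 * r) * (1 - 0.4 / 6)"
    using r by (simp add: field_simps)
  also have "\<dots> \<le> x * (1 - x\<^sup>2 / 6)"
    using x x2 r by (intro mult_mono) auto
  also have "\<dots> = x - x ^ 3 / 6"
    by (simp add: field_simps eval_nat_numeral)
  also have "\<dots> \<le> sin x"
    using x r by (intro sin_ge_diff_cube) auto
  also have "sin x = cos (pi * v / 2)"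
    by (simp add: cos_sin_eq x_def r_def field_simps)
  finally have "(1.46 * r)\<^sup>2 * (1 + v\<^sup>2) \<le> (cos (pi * v / 2))\<^sup>2 * (1 + v\<^sup>2)"
    using r by (intro mult_right_mono power_mono) auto
  moreover have "(1.46 * r)\<^sup>2 * (1 + v\<^sup>2) - (1 - v\<^sup>2)\<^sup>2 =
      r\<^sup>2 * (0.2632 - 0.2632 * r + 1.1316 * r\<^sup>2)"
    by (simp add: r_def power2_eq_square algebra_simps add_divide_distrib diff_divide_distrib)
  moreover have "r\<^sup>2 * (0.2632 - 0.2632 * r + 1.1316 * r\<^sup>2) \<ge> 0"
    using r by (intro mult_nonneg_nonneg) auto
  ultimately show ?thesis
    by linarith
qed

text \<open>Here d and 1 - d are the distances from a point to its two neighbouring integers.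
  Equality at the midpoint d = 1/2 explains the constant 8.\<close>

lemma sin_pi_two_point_bound:
  fixes d :: real
  assumes "0 < d" "d < 1"
  shows "8 \<le> (sin (pi * d))\<^sup>2 * (1 / d\<^sup>2 + 1 / (1 - d)\<^sup>2)"
proof -
  define v where "v = 1 - 2 * d"
  have v: "\<bar>v\<bar> < 1"
    using assms by (auto simp: v_def)
  then have v2: "1 - v\<^sup>2 > 0"
    by (simp add: abs_square_less_1)
  have "sin (pi * d) = cos (pi * v / 2)"
    by (simp add: sin_cos_eq v_def field_simps)
  also have "\<dots> = cos (pi * \<bar>v\<bar> / 2)"
    by (cases "v \<ge> 0") auto
  finally have le: "(1 - v\<^sup>2)\<^sup>2 \<le> (sin (pi * d))\<^sup>2 * (1 + v\<^sup>2)"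
    using cos_half_pi_square_bound[of "\<bar>v\<bar>"] v by simp
  have prod: "1 - v\<^sup>2 = 4 * (d * (1 - d))"
    by (simp add: v_def power2_eq_square algebra_simps)
  have "1 / d\<^sup>2 + 1 / (1 - d)\<^sup>2 = (d\<^sup>2 + (1 - d)\<^sup>2) / (d * (1 - d))\<^sup>2"
    using assms by (simp add: add_divide_eq_iff divide_add_eq_iff power_mult_distrib)
  also have "d\<^sup>2 + (1 - d)\<^sup>2 = (1 + v\<^sup>2) / 2"
    by (simp add: v_def power2_eq_square algebra_simps)
  also have "d * (1 - d) = (1 - v\<^sup>2) / 4"
    using prod by simp
  also have "(1 + v\<^sup>2) / 2 / ((1 - v\<^sup>2) / 4)\<^sup>2 = 8 * (1 + v\<^sup>2) / (1 - v\<^sup>2)\<^sup>2"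
    using v2 by (simp add: power_divide field_simps)
  finally have eq: "1 / d\<^sup>2 + 1 / (1 - d)\<^sup>2 = 8 * (1 + v\<^sup>2) / (1 - v\<^sup>2)\<^sup>2" .
  show ?thesis
    unfolding eq using le v2 by (simp add: field_simps)
qed

text \<open>Telescoping with 1/j^2 <= 1/(j - 1) - 1/j. The term left over at the upper end is
  positive, which makes the inequality strict, and with it the final bound for k >= 2.\<close>

lemma sum_inverse_squares_less:
  fixes k :: nat
  assumes "finite J" "\<And>j. j \<in> J \<Longrightarrow> k \<le> j" "k \<ge> 2"
  shows "(\<Sum>j\<in>J. 1 / (real j)\<^sup>2) < 1 / (real k - 1)"
proof -
  define n where "n = Suc (Max J)"
  have n: "J \<subseteq> {k..<k + n}"
  proof
    fix j assume "j \<in> J"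
    then show "j \<in> {k..<k + n}"
      using assms(2)[of j] Max_ge[OF assms(1), of j] by (simp add: n_def)
  qed
  have "(\<Sum>j\<in>J. 1 / (real j)\<^sup>2) \<le> (\<Sum>j\<in>{k..<k + n}. 1 / (real j)\<^sup>2)"
    using n by (intro sum_mono2) auto
  also have "\<dots> \<le> 1 / (real k - 1) - 1 / (real (k + n) - 1)"
  proof (induction n)
    case 0
    then show ?case by simp
  next
    case (Suc n)
    define a where "a = real (k + n)"
    have a: "a > 1"
      using assms(3) by (auto simp: a_def)
    have "1 / a\<^sup>2 \<le> 1 / (a * (a - 1))"
      using a by (intro divide_left_mono) (auto simp: power2_eq_square)
    also have "\<dots> = 1 / (a - 1) - 1 / a"
      using a by (simp add: field_simps)
    finally show ?case
      using Suc by (simp add: a_def add.commute)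
  qed
  also have "\<dots> < 1 / (real k - 1)"
    using assms(3) by simp
  finally show ?thesis .
qed

text \<open>Expanding \<open>cos (2 * (a + h))\<close> shows that the difference equals sin(2h) sin
  a cos a + cos(2a) sin^2 h exactly; the two terms give the two error terms of the theorem.\<close>

lemma sin_square_diff_bound:
  fixes a h c :: real
  assumes "0 \<le> a" "a \<le> pi / 2" "\<bar>h\<bar> \<le> c"
  shows "\<bar>(sin (a + h))\<^sup>2 - (sin a)\<^sup>2\<bar> \<le> 2 * c * (sin a * cos a) + c\<^sup>2"
proof -
  have sc: "0 \<le> sin a * cos a"
    using assms by (intro mult_nonneg_nonneg sin_ge_zero cos_ge_zero) auto
  have "cos (2 * (a + h)) = cos (2 * a) * cos (2 * h) - sin (2 * a) * sin (2 * h)"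
    by (simp add: cos_add distrib_left)
  then have "1 - 2 * (sin (a + h))\<^sup>2 =
      cos (2 * a) * (1 - 2 * (sin h)\<^sup>2) - (2 * sin a * cos a) * sin (2 * h)"
    by (simp only: cos_double_sin[of "a + h"] cos_double_sin[of h] sin_double[of a])
  then have "(sin (a + h))\<^sup>2 - (sin a)\<^sup>2 = sin (2 * h) * (sin a * cos a) + cos (2 * a) * (sin h)\<^sup>2"
    using cos_double_sin[of a] by (simp add: algebra_simps)
  also have "\<bar>\<dots>\<bar> \<le> \<bar>sin (2 * h)\<bar> * (sin a * cos a) + \<bar>cos (2 * a)\<bar> * (sin h)\<^sup>2"
    by (rule order.trans[OF abs_triangle_ineq])
       (simp add: abs_mult[of "sin (2 * h)"] abs_mult[of "cos (2 * a)"] abs_of_nonneg[OF sc])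
  also have "\<dots> \<le> (2 * c) * (sin a * cos a) + 1 * c\<^sup>2"
  proof (intro add_mono mult_right_mono mult_mono[where b = 1])
    show "\<bar>sin (2 * h)\<bar> \<le> 2 * c"
      using abs_sin_x_le_abs_x[of "2 * h"] assms(3) by simp
    have "\<bar>sin h\<bar>\<^sup>2 \<le> c\<^sup>2"
      using abs_sin_x_le_abs_x[of h] assms(3) by (intro power_mono) auto
    then show "(sin h)\<^sup>2 \<le> c\<^sup>2"
      by simp
  qed (use sc assms(3) in auto)
  finally show ?thesis
    by simp
qed

subsection \<open>The Fejer kernel on roots of unity\<close>

lemma sum_cis_orthogonal:
  fixes M :: nat
  assumes "j < M" "l < M"
  shows "(\<Sum>y<M. cis (2 * pi * real y * (real j - real l) / real M)) = (if j = l then of_nat M else 0)"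
proof (cases "j = l")
  case False
  define z where "z = cis (2 * pi * (real j - real l) / real M)"
  have inj: "inj_on (\<lambda>k. cis (2 * pi * real k / real M)) {..<M}"
    using Complex.bij_betw_roots_unity[of M] assms by (auto simp: bij_betw_def)
  have "z = cis (2 * pi * real j / real M) / cis (2 * pi * real l / real M)"
    by (simp add: z_def cis_divide right_diff_distrib diff_divide_distrib)
  then have "z \<noteq> 1"
    using inj_onD[OF inj, of j l] assms False by auto
  have "z ^ M = cis (2 * pi * (real j - real l))"
    using assms by (simp add: z_def Complex.DeMoivre)
  then have "z ^ M = 1"
    by (simp only: cis_multiple_2pi Ints_diff Ints_of_nat)
  have "(\<Sum>y<M. cis (2 * pi * real y * (real j - real l) / real M)) = (\<Sum>y<M. z ^ y)"
    by (intro sum.cong) (auto simp: z_def Complex.DeMoivre mult_ac)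
  also have "\<dots> = 0"
    using \<open>z \<noteq> 1\<close> \<open>z ^ M = 1\<close> by (simp add: sum_gp_strict)
  finally show ?thesis
    using False by simp
qed simp

text \<open>Up to normalisation the squared modulus of a Dirichlet sum. Defining it by the sum gives
  the right value 1 at x = 0, where the closed quotient of sines would be 0 / 0.\<close>

definition fejer :: "nat \<Rightarrow> real \<Rightarrow> real" where
  "fejer M x = (cmod (\<Sum>j<M. cis (2 * pi * real j * x / real M)) / real M)\<^sup>2"

lemma fejer_nonneg: "0 \<le> fejer M x"
  by (simp add: fejer_def)

lemma fejer_0: "M \<ge> 1 \<Longrightarrow> fejer M 0 = 1"
  by (simp add: fejer_def)

lemma fejer_minus: "fejer M (- x) = fejer M x"
proof -
  have "(\<Sum>j<M. cis (2 * pi * real j * (- x) / real M)) = cnj (\<Sum>j<M. cis (2 * pi * real j * x / real M))"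
    by (simp add: cis_cnj)
  then show ?thesis
    unfolding fejer_def by (simp only: complex_mod_cnj)
qed

lemma fejer_periodic:
  assumes "M \<ge> 1"
  shows "fejer M (x + real M) = fejer M x"
proof -
  have "cis (2 * pi * real j * (x + real M) / real M) = cis (2 * pi * real j * x / real M)" for j
  proof -
    have "2 * pi * real j * (x + real M) / real M = 2 * pi * real j * x / real M + 2 * pi * real j"
      using assms by (simp add: field_simps)
    then show ?thesis
      by (simp add: cis_mult[symmetric])
  qed
  then show ?thesis
    by (simp add: fejer_def)
qed

text \<open>Parseval: expand the squared modulus into a double sum over j and l. Summing over y
  first kills the off-diagonal terms, and each of the M diagonal terms contributes M / M^2.\<close>

lemma sum_fejer:
  assumes "M \<ge> 1"
  shows "(\<Sum>y<M. fejer M (w - real y)) = 1"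
proof -
  have "complex_of_real (\<Sum>y<M. fejer M (w - real y)) =
      (\<Sum>y<M. \<Sum>j<M. \<Sum>l<M. cis (2 * pi * w * (real l - real j) / real M) *
         cis (2 * pi * real y * (real j - real l) / real M)) / (of_nat M)\<^sup>2"
  proof -
    have "complex_of_real (fejer M (w - real y)) =
      (\<Sum>j<M. \<Sum>l<M. cis (2 * pi * w * (real l - real j) / real M) *
         cis (2 * pi * real y * (real j - real l) / real M)) / (of_nat M)\<^sup>2" for y
    proof -
      define g where "g = (\<lambda>j. cis (2 * pi * real j * (w - real y) / real M))"
      have "complex_of_real (fejer M (w - real y)) = cnj (sum g {..<M}) * sum g {..<M} / (of_nat M)\<^sup>2"
        unfolding fejer_def g_def[symmetric]
        by (simp add: power_divide complex_norm_square[symmetric] mult.commute del: cnj_sum)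
      also have "\<dots> = (\<Sum>j<M. \<Sum>l<M. cnj (g j) * g l) / (of_nat M)\<^sup>2"
        by (simp add: sum_product)
      also have "(\<lambda>j l. cnj (g j) * g l) = (\<lambda>j l. cis (2 * pi * w * (real l - real j) / real M) *
         cis (2 * pi * real y * (real j - real l) / real M))"
        by (intro ext, simp add: g_def cis_cnj cis_mult)
           (simp add: add_divide_distrib[symmetric] diff_divide_distrib[symmetric] algebra_simps)
      finally show ?thesis .
    qed
    then show ?thesis
      by (simp add: sum_divide_distrib)
  qed
  also have "\<dots> = (\<Sum>j<M. \<Sum>l<M. cis (2 * pi * w * (real l - real j) / real M) *
         (\<Sum>y<M. cis (2 * pi * real y * (real j - real l) / real M))) / (of_nat M)\<^sup>2"
    unfolding sum_distrib_left
    by (subst sum.swap, intro arg_cong2[where f = "(/)"] sum.cong refl sum.swap)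
  also have "\<dots> = (\<Sum>j<M. \<Sum>l<M. if j = l then of_nat M else 0) / (of_nat M)\<^sup>2"
    by (intro arg_cong2[where f = "(/)"] sum.cong refl) (auto simp: sum_cis_orthogonal)
  also have "\<dots> = 1"
    using assms by (simp add: power2_eq_square)
  finally show ?thesis
    by (simp only: of_real_eq_1_iff)
qed

lemma norm_one_minus_cis: "(cmod (1 - cis a))\<^sup>2 = 4 * (sin (a / 2))\<^sup>2"
proof -
  have "(cmod (1 - cis a))\<^sup>2 = 2 - 2 * cos a"
    by (simp add: cmod_power2 power2_diff sin_squared_eq)
  also have "cos a = 1 - 2 * (sin (a / 2))\<^sup>2"
    using cos_double_sin[of "a / 2"] by simp
  finally show ?thesis
    by simp
qed

lemma fejer_closed_form:
  assumes "M \<ge> 1" "sin (pi * x / real M) \<noteq> 0"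
  shows "fejer M x = (sin (pi * x))\<^sup>2 / (real M * sin (pi * x / real M))\<^sup>2"
proof -
  define z where "z = cis (2 * pi * x / real M)"
  have nz: "(cmod (1 - z))\<^sup>2 = 4 * (sin (pi * x / real M))\<^sup>2"
    by (simp add: z_def norm_one_minus_cis)
  then have "z \<noteq> 1"
    using assms(2) by auto
  have zM: "z ^ M = cis (2 * pi * x)"
    using assms(1) by (simp add: z_def Complex.DeMoivre)
  have "(\<Sum>j<M. cis (2 * pi * real j * x / real M)) = (\<Sum>j<M. z ^ j)"
    by (intro sum.cong) (auto simp: z_def Complex.DeMoivre mult_ac)
  also have "\<dots> = (1 - z ^ M) / (1 - z)"
    using \<open>z \<noteq> 1\<close> by (simp add: sum_gp_strict)
  finally have "fejer M x = (cmod (1 - z ^ M))\<^sup>2 / (cmod (1 - z))\<^sup>2 / (real M)\<^sup>2"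
    by (simp add: fejer_def norm_divide power_divide power_mult_distrib)
  then show ?thesis
    unfolding nz zM by (simp add: norm_one_minus_cis power_mult_distrib)
qed

lemma sin_pi_div_nonzero:
  assumes "M \<ge> 1" "x \<noteq> 0" "\<bar>x\<bar> < real M"
  shows "sin (pi * x / real M) \<noteq> 0"
proof -
  have "sin (pi * \<bar>x\<bar> / real M) > 0"
    using assms by (intro sin_gt_zero) (auto simp: field_simps)
  then show ?thesis
    by (cases "x \<ge> 0") auto
qed

text \<open>The numerator of the closed form is at most 1. Jordan's inequality bounds the
  denominator below, which is why x is confined to half a period.\<close>

lemma fejer_upper:
  assumes "M \<ge> 1" "x \<noteq> 0" "\<bar>x\<bar> \<le> real M / 2"
  shows "fejer M x \<le> 1 / (4 * x\<^sup>2)"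
proof -
  have sn: "sin (pi * x / real M) \<noteq> 0"
    using assms by (intro sin_pi_div_nonzero) auto
  have "2 * \<bar>x / real M\<bar> \<le> \<bar>sin (pi * (x / real M))\<bar>"
    using assms by (intro abs_sin_pi_ge_linear) (auto simp: field_simps)
  then have "2 * \<bar>x\<bar> \<le> \<bar>real M * sin (pi * x / real M)\<bar>"
    using assms by (simp add: abs_mult field_simps)
  then have "(2 * \<bar>x\<bar>)\<^sup>2 \<le> \<bar>real M * sin (pi * x / real M)\<bar>\<^sup>2"
    by (intro power_mono) auto
  then have le: "4 * x\<^sup>2 \<le> (real M * sin (pi * x / real M))\<^sup>2"
    by (simp add: power_mult_distrib)
  have "fejer M x \<le> 1 / (real M * sin (pi * x / real M))\<^sup>2"
    unfolding fejer_closed_form[OF assms(1) sn]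
    by (intro divide_right_mono) (auto simp: abs_square_le_1)
  also have "\<dots> \<le> 1 / (4 * x\<^sup>2)"
    using le assms(2) sn assms(1) by (intro divide_left_mono) auto
  finally show ?thesis .
qed

text \<open>The numerator is kept and |sin u| <= |u| is used in the denominator, giving a bound
  independent of \<open>M\<close>.\<close>

lemma fejer_lower:
  assumes "M \<ge> 1" "x \<noteq> 0" "\<bar>x\<bar> < real M"
  shows "(sin (pi * x))\<^sup>2 / (pi\<^sup>2 * x\<^sup>2) \<le> fejer M x"
proof -
  have sn: "sin (pi * x / real M) \<noteq> 0"
    using assms by (rule sin_pi_div_nonzero)
  have "\<bar>sin (pi * x / real M)\<bar> \<le> \<bar>pi * x / real M\<bar>"
    by (rule abs_sin_x_le_abs_x)
  then have "\<bar>real M * sin (pi * x / real M)\<bar> \<le> \<bar>pi * x\<bar>"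
    using assms by (simp add: abs_mult field_simps)
  then have "\<bar>real M * sin (pi * x / real M)\<bar>\<^sup>2 \<le> \<bar>pi * x\<bar>\<^sup>2"
    by (intro power_mono) auto
  then have "(real M * sin (pi * x / real M))\<^sup>2 \<le> pi\<^sup>2 * x\<^sup>2"
    by (simp add: power_mult_distrib)
  then show ?thesis
    unfolding fejer_closed_form[OF assms(1) sn]
    using sn assms by (intro divide_left_mono) auto
qed


subsection \<open>The reflection and the amplitudes of its powers\<close>

lemma QFT_cis:
  "QFT M v y = (\<Sum>x<M. cis (2 * pi * real x * real y / real M) / of_real (sqrt (real M)) * v x)"
  unfolding QFT_def cis_conv_exp by (intro sum.cong refl) (simp add: mult_ac)

lemma IQFT_cis:
  "IQFT M v y = (\<Sum>x<M. cis (- (2 * pi * real x * real y / real M)) / of_real (sqrt (real M)) * v x)"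
  unfolding IQFT_def cis_conv_exp by (intro sum.cong refl) (simp add: mult_ac)

lemma of_real_sqrt_mult_self: "complex_of_real (sqrt (real M)) * complex_of_real (sqrt (real M)) = of_nat M"
  by (simp add: of_real_mult[symmetric] del: of_real_mult)

lemma QFT_ket0:
  assumes "M \<ge> 1"
  shows "QFT M ket0 y = 1 / of_real (sqrt (real M))"
proof -
  have "QFT M ket0 y = (\<Sum>x<M. if x = 0 then 1 / of_real (sqrt (real M)) else 0)"
    unfolding QFT_cis ket0_def by (intro sum.cong) auto
  then show ?thesis
    using assms by simp
qed

lemma QFT_diff_scale: "QFT M (\<lambda>x. u x - c * v x) y = QFT M u y - c * QFT M v y"
  by (simp add: QFT_def right_diff_distrib left_diff_distrib diff_divide_distrib sum_subtractf
      sum_distrib_left mult_ac)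

lemma QFT_IQFT:
  assumes "y < N"
  shows "QFT N (IQFT N v) y = v y"
proof -
  have "QFT N (IQFT N v) y =
      (\<Sum>x<N. \<Sum>z<N. cis (2 * pi * real x * (real y - real z) / real N) * (v z / of_nat N))"
    unfolding QFT_cis IQFT_cis sum_distrib_left
  proof (intro sum.cong refl)
    fix x z
    have "cis (2 * pi * real x * (real y - real z) / real N) =
        cis (2 * pi * real x * real y / real N) * cis (- (2 * pi * real z * real x / real N))"
      by (simp add: cis_mult) (simp add: diff_divide_distrib[symmetric] algebra_simps)
    then show "cis (2 * pi * real x * real y / real N) / of_real (sqrt (real N)) *
        (cis (- (2 * pi * real z * real x / real N)) / of_real (sqrt (real N)) * v z) =
        cis (2 * pi * real x * (real y - real z) / real N) * (v z / of_nat N)"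
      by (simp add: of_real_sqrt_mult_self[symmetric])
  qed
  also have "\<dots> = (\<Sum>z<N. (\<Sum>x<N. cis (2 * pi * real x * (real y - real z) / real N)) * (v z / of_nat N))"
    unfolding sum_distrib_right by (rule sum.swap)
  also have "\<dots> = (\<Sum>z<N. if z = y then v y else 0)"
    using assms by (intro sum.cong refl) (auto simp: sum_cis_orthogonal)
  finally show ?thesis
    using assms by simp
qed

text \<open>\<open>S_0\<close> subtracts twice the component along \<open>ket0\<close>. Conjugation
  by the Fourier transform turns this into inversion about the mean, because
  \<open>QFT N ket0\<close> is uniform.\<close>

lemma Q_op_reflection:
  assumes "x < N"
  shows "Q_op N f v x = 2 / of_nat N * (\<Sum>z<N. S_f f v z) - S_f f v x"
proof -
  define u where "u = IQFT N (S_f f v)"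
  have u0: "u 0 = (\<Sum>z<N. S_f f v z) / of_real (sqrt (real N))"
    by (simp add: u_def IQFT_cis sum_divide_distrib)
  have "S_0 u = (\<lambda>x. u x - 2 * u 0 * ket0 x)"
    by (auto simp: S_0_def ket0_def)
  then have "Q_op N f v x = 2 * u 0 * QFT N ket0 x - QFT N u x"
    by (simp add: Q_op_def u_def QFT_diff_scale)
  also have "QFT N u x = S_f f v x"
    unfolding u_def by (rule QFT_IQFT[OF assms])
  also have "QFT N ket0 x = 1 / of_real (sqrt (real N))"
    using assms by (intro QFT_ket0) auto
  finally show ?thesis
    by (simp add: u0 of_real_sqrt_mult_self)
qed

section \<open>The rotation angle and the rotated amplitudes\<close>

locale quantum_counting =
  fixes N M :: nat and f :: "nat \<Rightarrow> bool"
  assumes N_pos: "N \<ge> 1" and M_pos: "M \<ge> 1"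
begin

definition t :: nat where "t = card {x. x < N \<and> f x}"

definition theta :: real where "theta = arcsin (sqrt (real t / real N))"

definition omega :: real where "omega = real M * theta / pi"

lemma t_le: "t \<le> N"
  unfolding t_def using card_mono[of "{..<N}" "{x. x < N \<and> f x}"] by auto

lemma sqrt_ratio_le: "sqrt (real t / real N) \<le> 1"
  using t_le N_pos by simp

lemma sin_theta: "sin theta = sqrt (real t / real N)"
  unfolding theta_def
  by (rule sin_arcsin) (use sqrt_ratio_le in \<open>auto intro: order.trans[of _ 0]\<close>)

lemma cos_theta: "cos theta = sqrt (real (N - t) / real N)"
proof -
  have "cos theta = sqrt (1 - real t / real N)"
    unfolding theta_def
    by (subst cos_arcsin) (use sqrt_ratio_le in \<open>auto intro: order.trans[of _ 0]\<close>)
  then show ?thesis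
    using t_le N_pos by (simp add: field_simps)
qed

lemma theta_bounds: "0 \<le> theta" "theta \<le> pi / 2"
proof -
  show "0 \<le> theta"
    unfolding theta_def using sqrt_ratio_le by (intro arcsin_nonneg) auto
  show "theta \<le> pi / 2"
    unfolding theta_def
    by (rule arcsin_ubound) (use sqrt_ratio_le in \<open>auto intro: order.trans[of _ 0]\<close>)
qed

lemma omega_bounds: "0 \<le> omega" "omega \<le> real M / 2"
proof -
  show "0 \<le> omega"
    using theta_bounds by (simp add: omega_def)
  have "real M * theta \<le> real M * (pi / 2)"
    using theta_bounds by (intro mult_left_mono) auto
  then show "omega \<le> real M / 2"
    by (simp add: omega_def field_simps)
qed

lemma sum_marked:
  "(\<Sum>x<N. if f x then a else b) = of_nat t * a + of_nat (N - t) * (b :: 'a :: comm_ring_1)"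
proof -
  have "card ({..<N} \<inter> - {x. f x}) = card ({..<N} - {x. x < N \<and> f x})"
    by (rule arg_cong[where f = card]) auto
  also have "\<dots> = N - t"
    unfolding t_def by (subst card_Diff_subset) auto
  finally have "card ({..<N} \<inter> - {x. f x}) = N - t" .
  moreover have "{..<N} \<inter> {x. f x} = {x. x < N \<and> f x}"
    by auto
  ultimately show ?thesis
    by (simp add: sum.If_cases t_def)
qed

lemma t_pos: "x < N \<Longrightarrow> f x \<Longrightarrow> t > 0"
  unfolding t_def by (auto simp: card_gt_0_iff)

lemma t_less:
  assumes "x < N" "\<not> f x"
  shows "t < N"
proof -
  have "card {x. x < N \<and> f x} < card {..<N}"
    using assms by (intro psubset_card_mono) auto
  then show ?thesis
    by (simp add: t_def)
qed

text \<open>The unit vector at angle (2 j + 1) theta, its sine part spread evenly over the marked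
  states and its cosine part over the unmarked ones. A zero denominator occurs only for a class with
  no member below \<open>N\<close>.\<close>

definition amplitude :: "nat \<Rightarrow> nat \<Rightarrow> real" where
  "amplitude j x = (if f x then sin (real (2 * j + 1) * theta) / sqrt (real t)
     else cos (real (2 * j + 1) * theta) / sqrt (real (N - t)))"

lemma sqrt_t: "sqrt (real t) = sqrt (real N) * sin theta"
  using N_pos by (simp add: sin_theta real_sqrt_divide)

lemma sqrt_N_minus_t: "sqrt (real (N - t)) = sqrt (real N) * cos theta"
  using N_pos by (simp add: cos_theta real_sqrt_divide)

lemma amplitude_0:
  assumes "x < N"
  shows "amplitude 0 x = 1 / sqrt (real N)"
proof (cases "f x")
  case True
  then have "sqrt (real t) > 0"
    using t_pos[OF assms] by simp
  then have "sin theta \<noteq> 0"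
    by (auto simp: sqrt_t)
  then show ?thesis
    using True by (simp add: amplitude_def sqrt_t)
next
  case False
  then have "sqrt (real (N - t)) > 0"
    using t_less[OF assms] by simp
  then have "cos theta \<noteq> 0"
    by (auto simp: sqrt_N_minus_t)
  then show ?thesis
    using False by (simp add: amplitude_def sqrt_N_minus_t)
qed

text \<open>Supplies the mean needed in \<open>Q_op_reflection\<close>: weighting the two classes by
  their sizes gives sqrt N (cos theta cos a - sin theta sin a).\<close>

lemma sum_signed_amplitude:
  "(\<Sum>x<N. if f x then - amplitude j x else amplitude j x) = sqrt (real N) * cos (real (2 * j + 2) * theta)"
proof -
  define a where "a = real (2 * j + 1) * theta"
  have sum_eq: "(\<Sum>x<N. if f x then - amplitude j x else amplitude j x) =
      (\<Sum>x<N. if f x then - (sin a / sqrt (real t)) else cos a / sqrt (real (N - t)))"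
    by (intro sum.cong) (auto simp: amplitude_def a_def)
  \<comment> \<open>This also holds for n = 0, so an empty marked or unmarked class needs no
    separate case.\<close>
  have "real n * (y / sqrt (real n)) = sqrt (real n) * y" for n y
    by (metis mult.commute real_div_sqrt of_nat_0_le_iff times_divide_eq_left times_divide_eq_right)
  then have "(\<Sum>x<N. if f x then - amplitude j x else amplitude j x) =
      sqrt (real (N - t)) * cos a - sqrt (real t) * sin a"
    unfolding sum_eq sum_marked by simp
  also have "\<dots> = sqrt (real N) * cos (a + theta)"
    unfolding sqrt_t sqrt_N_minus_t by (simp add: cos_add algebra_simps)
  also have "a + theta = real (2 * j + 2) * theta"
    by (simp add: a_def algebra_simps)
  finally show ?thesis .
qed

text \<open>With b = (2 j + 2) theta midway between the two angles, these are sin(b + theta) - sin(b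
  - theta) = 2 cos b sin theta and cos(b + theta) + cos(b - theta) = 2 cos b cos theta.\<close>

lemma amplitude_Suc:
  assumes "x < N"
  shows "amplitude (Suc j) x = 2 / real N * (sqrt (real N) * cos (real (2 * j + 2) * theta))
    - (if f x then - amplitude j x else amplitude j x)"
proof -
  define b where "b = real (2 * j + 2) * theta"
  have b: "real (2 * j + 1) * theta = b - theta" "real (2 * Suc j + 1) * theta = b + theta"
    by (simp_all add: b_def algebra_simps)
  have N: "2 / real N * (sqrt (real N) * y) = 2 * y / sqrt (real N)" for y
    using N_pos by (simp add: field_simps)
  show ?thesis
  proof (cases "f x")
    case True
    then have "sqrt (real t) > 0"
      using t_pos[OF assms] by simp
    then have "sin theta \<noteq> 0"
      by (auto simp: sqrt_t)
    then show ?thesis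
      using True N_pos unfolding amplitude_def b N b_def[symmetric] sqrt_t
      by (simp add: sin_add sin_diff field_simps)
  next
    case False
    then have "sqrt (real (N - t)) > 0"
      using t_less[OF assms] by simp
    then have "cos theta \<noteq> 0"
      by (auto simp: sqrt_N_minus_t)
    then show ?thesis
      using False N_pos unfolding amplitude_def b N b_def[symmetric] sqrt_N_minus_t
      by (simp add: cos_add cos_diff field_simps)
  qed
qed

text \<open>A constant start vector suffices, since \<open>QFT N ket0\<close> is constant and the
  transform of the first register only rescales it.\<close>

lemma Q_op_power:
  assumes "x < N"
  shows "(Q_op N f ^^ j) (\<lambda>_. c) x = c * of_real (sqrt (real N) * amplitude j x)"
  using assms
proof (induction j arbitrary: x)
  case 0
  then show ?case
    using N_pos by (simp add: amplitude_0)
next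
  case (Suc j)
  define v where "v = (Q_op N f ^^ j) (\<lambda>_. c)"
  have S: "S_f f v x = c * of_real (sqrt (real N)) *
      of_real (if f x then - amplitude j x else amplitude j x)" if "x < N" for x
    using Suc.IH[OF that] by (simp add: S_f_def v_def)
  have "(\<Sum>z<N. S_f f v z) = c * of_real (sqrt (real N)) *
      of_real (\<Sum>z<N. if f z then - amplitude j z else amplitude j z)"
    by (simp add: S sum_distrib_left)
  then have "Q_op N f v x = c * of_real (sqrt (real N)) * of_real (amplitude (Suc j) x)"
    unfolding Q_op_reflection[OF Suc.prems] amplitude_Suc[OF Suc.prems] sum_signed_amplitude S[OF Suc.prems]
    by (simp add: algebra_simps)
  then show ?case
    by (simp add: v_def)
qed

section \<open>The state before measurement and its outcome distribution\<close>

lemma est_amp_state_eq: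
  assumes "x < N"
  shows "est_amp_state N f M y x =
    (\<Sum>j<M. cis (- (2 * pi * real j * real y / real M)) / of_nat M * of_real (amplitude j x))"
proof -
  define c where "c = (1 :: complex) / of_real (sqrt (real M)) / of_real (sqrt (real N))"
  \<comment> \<open>For fixed x this is a multiple of \<open>ket0\<close>, written as a difference
    so that \<open>QFT_diff_scale\<close> applies.\<close>
  have psi0: "(\<lambda>j. (if j = 0 then QFT N ket0 else (\<lambda>_. 0)) x) =
      (\<lambda>j. 0 - (- 1 / of_real (sqrt (real N))) * ket0 j)" for x
    by (rule ext, simp add: QFT_ket0[OF N_pos]) (simp add: ket0_def)
  have "on_first (QFT M) (\<lambda>j. if j = 0 then QFT N ket0 else (\<lambda>_. 0)) = (\<lambda>_ _. c)"
    unfolding on_first_def psi0 QFT_diff_scale QFT_ket0[OF M_pos]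
    by (simp add: QFT_def c_def mult.commute)
  then have "est_amp_state N f M y x = IQFT M (\<lambda>j. (Q_op N f ^^ j) (\<lambda>_. c) x) y"
    unfolding est_amp_state_def Let_def by (simp add: on_first_def Lambda_def)
  also have "\<dots> = (\<Sum>j<M. cis (- (2 * pi * real j * real y / real M)) / of_nat M * of_real (amplitude j x))"
    unfolding IQFT_cis Q_op_power[OF assms]
    using N_pos by (intro sum.cong refl) (simp add: c_def of_real_sqrt_mult_self[symmetric])
  finally show ?thesis .
qed

text \<open>This and the next lemma cover an empty class in \<open>meas_prob_eq\<close>: division by
  its size 0 yields 0, and the matching Fourier coefficient vanishes as well.\<close>

lemma sin_odd_multiple_zero: "t = 0 \<Longrightarrow> sin (real (2 * j + 1) * theta) = 0"
  by (simp add: theta_def)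

lemma cos_odd_multiple_zero:
  assumes "t = N"
  shows "cos (real (2 * j + 1) * theta) = 0"
proof -
  have "theta = pi / 2"
    using assms N_pos by (simp add: theta_def)
  then have "real (2 * j + 1) * theta = real j * pi + pi / 2"
    by (simp add: algebra_simps)
  then show ?thesis
    by (simp add: cos_add)
qed

text \<open>Summing over the second register leaves |S|^2 + |C|^2, with S and C the Fourier
  coefficients of the sines and cosines. By the parallelogram law this is the average for C + i S
  and C - i S, the coefficients of pure exponentials.\<close>

lemma meas_prob_eq: "meas_prob N f M y = (fejer M (omega - real y) + fejer M (- omega - real y)) / 2"
proof -
  define e where "e = (\<lambda>j. cis (- (2 * pi * real j * real y / real M)) / of_nat M)"
  define S C where "S = (\<Sum>j<M. e j * of_real (sin (real (2 * j + 1) * theta)))"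
    and "C = (\<Sum>j<M. e j * of_real (cos (real (2 * j + 1) * theta)))"
  have "meas_prob N f M y = (\<Sum>x<N. if f x then (cmod S)\<^sup>2 / real t else (cmod C)\<^sup>2 / real (N - t))"
    unfolding meas_prob_def
  proof (intro sum.cong refl)
    fix x assume "x \<in> {..<N}"
    then have "est_amp_state N f M y x =
        (if f x then S / of_real (sqrt (real t)) else C / of_real (sqrt (real (N - t))))"
      by (auto simp: est_amp_state_eq amplitude_def S_def C_def e_def sum_divide_distrib mult.commute)
    then show "(cmod (est_amp_state N f M y x))\<^sup>2 =
        (if f x then (cmod S)\<^sup>2 / real t else (cmod C)\<^sup>2 / real (N - t))"
      by (simp add: norm_divide power_divide)
  qed
  also have "\<dots> = real t * ((cmod S)\<^sup>2 / real t) + real (N - t) * ((cmod C)\<^sup>2 / real (N - t))"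
    by (rule sum_marked)
  also have "real t * ((cmod S)\<^sup>2 / real t) = (cmod S)\<^sup>2"
    using sin_odd_multiple_zero by (cases "t = 0") (simp_all add: S_def)
  also have "real (N - t) * ((cmod C)\<^sup>2 / real (N - t)) = (cmod C)\<^sup>2"
  proof (cases "t = N")
    case True
    then show ?thesis
      unfolding C_def cos_odd_multiple_zero[OF True] by simp
  next
    case False
    then show ?thesis
      using t_le by simp
  qed
  also have "(cmod S)\<^sup>2 + (cmod C)\<^sup>2 = ((cmod (C + \<i> * S))\<^sup>2 + (cmod (C - \<i> * S))\<^sup>2) / 2"
    by (simp add: cmod_power2 power2_sum power2_diff)
  finally have meas: "meas_prob N f M y = ((cmod (C + \<i> * S))\<^sup>2 + (cmod (C - \<i> * S))\<^sup>2) / 2" .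
  \<comment> \<open>The odd multiple 2 j + 1 contributes a factor \<open>cis (s * theta)\<close>
    independent of j, which the modulus removes.\<close>
  have fej: "fejer M (s * omega - real y) = (cmod (\<Sum>j<M. e j * cis (s * (real (2 * j + 1) * theta))))\<^sup>2" for s
  proof -
    have "e j * cis (s * (real (2 * j + 1) * theta)) =
        cis (s * theta) / of_nat M * cis (2 * pi * real j * (s * omega - real y) / real M)" for j
    proof -
      have "2 * pi * real j * (s * omega - real y) / real M =
          2 * s * real j * theta - 2 * pi * real j * real y / real M"
        using M_pos by (simp add: omega_def field_simps)
      then show ?thesis
        by (simp add: e_def cis_mult) (simp add: algebra_simps)
    qed
    then show ?thesis
      by (simp only: fejer_def sum_distrib_left[symmetric] norm_mult norm_divide norm_cis norm_of_nat) simp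
  qed
  have cis_eq: "cis a = of_real (cos a) + \<i> * of_real (sin a)" for a
    by (simp add: complex_eq_iff)
  have "C + \<i> * S = (\<Sum>j<M. e j * cis (1 * (real (2 * j + 1) * theta)))"
    by (simp add: C_def S_def cis_eq sum_distrib_left sum.distrib[symmetric] algebra_simps)
  moreover have "C - \<i> * S = (\<Sum>j<M. e j * cis (- 1 * (real (2 * j + 1) * theta)))"
    by (simp add: C_def S_def cis_eq sum_distrib_left sum_subtractf[symmetric] right_diff_distrib mult_ac)
  ultimately show ?thesis
    using fej[of 1] fej[of "- 1"] by (simp add: meas)
qed

section \<open>Folding the two kernels into one\<close>

lemma count_output_reflect:
  assumes "y \<le> M"
  shows "count_output N M (M - y) = count_output N M y"
proof -
  have "pi * real (M - y) / real M = pi - pi * real y / real M"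
    using assms M_pos by (simp add: of_nat_diff field_simps)
  then show ?thesis
    by (simp add: count_output_def)
qed

lemma count_prob_eq:
  "count_prob N f M P = (\<Sum>y\<in>{y. y < M \<and> P (count_output N M y)}. fejer M (omega - real y))"
proof -
  define G where "G = {y. y < M \<and> P (count_output N M y)}"
  \<comment> \<open>Negation modulo M. The outcome 0 is its own mirror image, as M - 0 is out of
    range.\<close>
  define r where "r = (\<lambda>y. if y = 0 then 0 else M - y)"
  have rG: "r y \<in> G" if "y \<in> G" for y
    using that count_output_reflect[of y] by (auto simp: G_def r_def)
  have rr: "r (r y) = y" if "y \<in> G" for y
    using that by (auto simp: G_def r_def)
  have "(\<Sum>y\<in>G. fejer M (- omega - real y)) = (\<Sum>y\<in>G. fejer M (omega - real y))"
  proof (rule sum.reindex_bij_witness[of _ r r])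
    fix y assume "y \<in> G"
    then have y: "y < M"
      by (simp add: G_def)
    show "fejer M (omega - real (r y)) = fejer M (- omega - real y)"
    proof (cases "y = 0")
      case True
      then show ?thesis
        using fejer_minus[of M omega] by (simp add: r_def)
    next
      case False
      then have "omega - real (r y) + real M = omega + real y"
        using y by (simp add: r_def of_nat_diff)
      then have "fejer M (omega - real (r y)) = fejer M (omega + real y)"
        using fejer_periodic[OF M_pos, of "omega - real (r y)"] by (simp only:)
      also have "\<dots> = fejer M (- omega - real y)"
        using fejer_minus[of M "omega + real y"] by simp
      finally show ?thesis .
    qed
  qed (use rG rr in auto)
  then show ?thesis
    unfolding count_prob_def G_def[symmetric] meas_prob_eq
    by (simp add: sum_divide_distrib[symmetric] sum.distrib)
qed

section \<open>Concentration near omega and accuracy of the estimate\<close>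

lemma count_prob_eq_1I:
  assumes "y < M" "omega = real y" "P (count_output N M y)"
  shows "count_prob N f M P = 1"
proof (rule antisym)
  have "(\<Sum>y\<in>{y. y < M \<and> P (count_output N M y)}. fejer M (omega - real y)) \<le> (\<Sum>y<M. fejer M (omega - real y))"
    by (intro sum_mono2) (auto simp: fejer_nonneg)
  then show "count_prob N f M P \<le> 1"
    by (simp add: count_prob_eq sum_fejer[OF M_pos])
  \<comment> \<open>When omega is itself an outcome, the kernel puts its whole mass there.\<close>
  have "1 = fejer M (omega - real y)"
    using assms M_pos by (simp add: fejer_0)
  also have "\<dots> \<le> count_prob N f M P"
    unfolding count_prob_eq using assms by (intro member_le_sum) (auto simp: fejer_nonneg)
  finally show "1 \<le> count_prob N f M P" .
qed


text \<open>\<open>s = M\<close> covers outcomes whose cyclic distance to \<open>\<omega>\<close> wraps around.\<close>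

lemma count_output_near:
  assumes "s = 0 \<or> s = real M" "\<bar>omega - real y + s\<bar> \<le> real k"
  shows "\<bar>count_output N M y - real t\<bar> \<le> 2 * pi * real k * sqrt (real t * real (N - t)) / real M
      + pi\<^sup>2 * (real k)\<^sup>2 * real N / (real M)\<^sup>2"
proof -
  define h c where "h = - (pi / real M * (omega - real y + s))" and "c = pi / real M * real k"
  have h: "\<bar>h\<bar> \<le> c"
    unfolding h_def c_def abs_minus_cancel abs_mult using assms(2) M_pos by (simp add: divide_right_mono)
  have "theta + h = pi * real y / real M - pi * s / real M"
    using M_pos by (simp add: h_def omega_def field_simps)
  \<comment> \<open>The shift \<open>pi * s / M\<close> is 0 or pi, which the squared sine
    ignores.\<close>
  then have "(sin (theta + h))\<^sup>2 = (sin (pi * real y / real M))\<^sup>2"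
    using assms(1) M_pos by (auto simp: sin_diff)
  moreover have "real t = real N * (sin theta)\<^sup>2"
    using N_pos by (simp add: sin_theta)
  ultimately have "count_output N M y - real t = real N * ((sin (theta + h))\<^sup>2 - (sin theta)\<^sup>2)"
    by (simp add: count_output_def right_diff_distrib)
  then have "\<bar>count_output N M y - real t\<bar> = real N * \<bar>(sin (theta + h))\<^sup>2 - (sin theta)\<^sup>2\<bar>"
    by (simp add: abs_mult)
  also have "\<dots> \<le> real N * (2 * c * (sin theta * cos theta) + c\<^sup>2)"
    by (intro mult_left_mono sin_square_diff_bound theta_bounds h) auto
  also have "\<dots> = 2 * c * (real N * (sin theta * cos theta)) + real N * c\<^sup>2"
    by (simp add: algebra_simps)
  also have "real N * (sin theta * cos theta) = sqrt (real t * real (N - t))"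
    by (simp add: real_sqrt_mult sqrt_t sqrt_N_minus_t)
  finally show ?thesis
    by (simp add: c_def power_mult_distrib power_divide mult_ac)
qed

text \<open>
  Here \<open>g y\<close> is a representative of \<open>\<omega> - y\<close> modulo \<open>M\<close> and \<open>h y\<close> the integer part of its absolute
  value, which is injective on each side of \<open>\<omega>\<close>.
\<close>

lemma fejer_tail:
  assumes "finite A" "inj_on h A" "k \<ge> 2"
    and g: "\<And>y. y \<in> A \<Longrightarrow> fejer M (omega - real y) = fejer M (g y) \<and>
      \<bar>g y\<bar> \<le> real M / 2 \<and> k \<le> h y \<and> real (h y) \<le> \<bar>g y\<bar>"
  shows "(\<Sum>y\<in>A. fejer M (omega - real y)) < 1 / (4 * (real k - 1))"
proof -
  have "(\<Sum>y\<in>A. fejer M (omega - real y)) \<le> (\<Sum>y\<in>A. 1 / 4 * (1 / (real (h y))\<^sup>2))"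
  proof (rule sum_mono)
    fix y assume y: "y \<in> A"
    have h: "real (h y) > 0"
      using g[OF y] assms(3) by simp
    then have "fejer M (g y) \<le> 1 / (4 * (g y)\<^sup>2)"
      using g[OF y] by (intro fejer_upper M_pos) auto
    also have "(real (h y))\<^sup>2 \<le> \<bar>g y\<bar>\<^sup>2"
      using g[OF y] by (intro power_mono) auto
    then have "1 / (4 * (g y)\<^sup>2) \<le> 1 / (4 * (real (h y))\<^sup>2)"
      using h g[OF y] by (intro divide_left_mono mult_pos_pos) auto
    finally show "fejer M (omega - real y) \<le> 1 / 4 * (1 / (real (h y))\<^sup>2)"
      using g[OF y] by simp
  qed
  also have "\<dots> = 1 / 4 * (\<Sum>j\<in>h ` A. 1 / (real j)\<^sup>2)"
    by (simp add: sum.reindex[OF assms(2)] sum_distrib_left)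
  also have "\<dots> < 1 / 4 * (1 / (real k - 1))"
    using assms g by (intro mult_strict_left_mono sum_inverse_squares_less) auto
  finally show ?thesis
    by simp
qed

text \<open>The bad outcomes are bounded instead. Splitting them by the side of omega makes their
  integer distances distinct and at least k, so \<open>fejer_tail\<close> applies to each
  side.\<close>

lemma count_prob_good_gt:
  assumes "k \<ge> 2"
    and near: "\<And>y s. s = 0 \<or> s = real M \<Longrightarrow> \<bar>omega - real y + s\<bar> \<le> real k \<Longrightarrow> P (count_output N M y)"
  shows "1 - 1 / (2 * (real k - 1)) < count_prob N f M P"
proof -
  define B where "B = {y. y < M \<and> \<not> P (count_output N M y)}"
  define e where "e = 1 / (4 * (real k - 1))"
  \<comment> \<open>The far outcomes on the left of \<open>\<omega>\<close> modulo \<open>M\<close>, including those that wrap around.\<close>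
  define L where "L = {y \<in> B. real y \<le> omega \<or> omega - real y < - (real M / 2)}"
  define R where "R = {y \<in> B. omega < real y \<and> - (real M / 2) \<le> omega - real y}"
  have far: "real k < \<bar>omega - real y\<bar>" "real k < \<bar>omega - real y + real M\<bar>" if "y \<in> B" for y
    using near[of 0 y] near[of "real M" y] that by (fastforce simp: B_def)+
  have yM: "y < M" if "y \<in> B" for y
    using that by (simp add: B_def)
  have fin: "finite B" "finite L" "finite R"
    by (auto simp: B_def L_def R_def)
  have "(\<Sum>y\<in>L. fejer M (omega - real y)) < e"
    unfolding e_def
  proof (rule fejer_tail[OF \<open>finite L\<close> _ assms(1)])
    define g where "g = (\<lambda>y. omega - real y + (if real y \<le> omega then 0 else real M))"
    define q where "q = (\<lambda>y. \<lfloor>omega\<rfloor> - int y + (if real y \<le> omega then 0 else int M))"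
    \<comment> \<open>For y <= omega the bound M / 2 comes from \<open>omega_bounds\<close>.
      Otherwise it comes from the wrap-around condition, and y < M keeps the shifted offset
      positive.\<close>
    have g: "real k < g y \<and> g y \<le> real M / 2 \<and> fejer M (omega - real y) = fejer M (g y)" if "y \<in> L" for y
    proof (cases "real y \<le> omega")
      case True
      then show ?thesis
        using far[of y] that omega_bounds by (auto simp: L_def g_def)
    next
      case False
      then have "omega - real y < - (real M / 2)"
        using that by (simp add: L_def)
      then show ?thesis
        using far[of y] yM[of y] that omega_bounds False fejer_periodic[OF M_pos, of "omega - real y"]
        by (auto simp: L_def g_def)
    qed
    \<comment> \<open>\<open>q y\<close> is the floor of \<open>g y\<close>, because the shift is an
      integer.\<close>
    have q: "int k \<le> q y \<and> real_of_int (q y) \<le> g y" if "y \<in> L" for y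
    proof -
      have "real_of_int (q y) \<le> g y" "g y < real_of_int (q y) + 1"
        unfolding q_def g_def using floor_correct[of omega] by (simp_all add: algebra_simps)
      then show ?thesis
        using g[OF that] by linarith
    qed
    \<comment> \<open>If only one of the two wrapped around, equal values of \<open>q\<close> would
      make y and z differ by M.\<close>
    have "y = z" if "y \<in> L" "z \<in> L" "q y = q z" for y z
    proof -
      have "y < M" "z < M"
        using that yM by (auto simp: L_def)
      then show ?thesis
        using that(3) by (auto simp: q_def split: if_splits)
    qed
    then show "inj_on (\<lambda>y. nat (q y)) L"
      using q by (intro inj_onI) (metis eq_nat_nat_iff of_nat_0_le_iff order_trans)
    show "fejer M (omega - real y) = fejer M (g y) \<and> \<bar>g y\<bar> \<le> real M / 2 \<and> k \<le> nat (q y) \<and>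
        real (nat (q y)) \<le> \<bar>g y\<bar>" if "y \<in> L" for y
      using g[OF that] q[OF that] by auto
  qed
  moreover have "(\<Sum>y\<in>R. fejer M (omega - real y)) < e"
    unfolding e_def
  proof (rule fejer_tail[OF \<open>finite R\<close> _ assms(1)])
    have q: "int k \<le> int y - \<lceil>omega\<rceil> \<and> real_of_int (int y - \<lceil>omega\<rceil>) \<le> \<bar>omega - real y\<bar> \<and>
        \<bar>omega - real y\<bar> \<le> real M / 2" if "y \<in> R" for y
      using that far(1)[of y] unfolding R_def by simp linarith
    show "inj_on (\<lambda>y. nat (int y - \<lceil>omega\<rceil>)) R"
    proof (rule inj_onI)
      fix y z assume "y \<in> R" "z \<in> R" "nat (int y - \<lceil>omega\<rceil>) = nat (int z - \<lceil>omega\<rceil>)"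
      then show "y = z"
        using q[of y] q[of z] by (simp add: nat_eq_iff)
    qed
    show "fejer M (omega - real y) = fejer M (omega - real y) \<and> \<bar>omega - real y\<bar> \<le> real M / 2 \<and>
        k \<le> nat (int y - \<lceil>omega\<rceil>) \<and> real (nat (int y - \<lceil>omega\<rceil>)) \<le> \<bar>omega - real y\<bar>" if "y \<in> R" for y
      using q[OF that] by auto
  qed
  moreover have "(\<Sum>y\<in>B. fejer M (omega - real y)) =
      (\<Sum>y\<in>L. fejer M (omega - real y)) + (\<Sum>y\<in>R. fejer M (omega - real y))"
  proof -
    have "B = L \<union> R" "L \<inter> R = {}"
      by (auto simp: L_def R_def)
    then show ?thesis
      using fin by (simp add: sum.union_disjoint)
  qed
  moreover have "count_prob N f M P + (\<Sum>y\<in>B. fejer M (omega - real y)) = 1"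
  proof -
    have "{..<M} = {y. y < M \<and> P (count_output N M y)} \<union> B"
      by (auto simp: B_def)
    moreover have "{y. y < M \<and> P (count_output N M y)} \<inter> B = {}"
      by (auto simp: B_def)
    ultimately show ?thesis
      unfolding count_prob_eq sum_fejer[OF M_pos, of omega, symmetric]
      using fin by (simp add: sum.union_disjoint)
  qed
  ultimately have "1 - (e + e) < count_prob N f M P"
    by linarith
  moreover have "1 / (2 * (real k - 1)) = e + e"
    using assms(1) by (simp add: e_def field_simps)
  ultimately show ?thesis
    by (simp only:)
qed

lemma count_prob_good_ge:
  assumes near: "\<And>y. \<bar>omega - real y\<bar> \<le> 1 \<Longrightarrow> P (count_output N M y)"
  shows "8 / pi\<^sup>2 \<le> count_prob N f M P"
proof -
  have "3\<^sup>2 \<le> pi\<^sup>2"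
    using pi_gt3 by (intro power_mono) auto
  then have pi8: "8 / pi\<^sup>2 \<le> 1"
    by simp
  define n d where "n = nat \<lfloor>omega\<rfloor>" and "d = omega - real n"
  have d: "0 \<le> d" "d < 1"
    unfolding n_def d_def using omega_bounds(1) by linarith+
  show ?thesis
  proof (cases "d = 0")
    case True
    have "n < M"
      using True omega_bounds M_pos by (simp add: d_def)
    then have "count_prob N f M P = 1"
      using True near[of n] by (intro count_prob_eq_1I[of n]) (auto simp: d_def)
    then show ?thesis
      using pi8 by simp
  next
    case False
    then have d0: "0 < d"
      using d by simp
    have n: "real n < real M / 2"
      using d0 omega_bounds by (simp add: d_def)
    show ?thesis
    \<comment> \<open>For M = 1 the upper neighbour n + 1 is not an outcome, but 0 is then the only
      outcome and is within distance 1 of omega.\<close>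
    proof (cases "M = 1")
      case True
      then have "{y. y < M \<and> P (count_output N M y)} = {0}"
        using near[of 0] omega_bounds by auto
      then have "count_prob N f M P = 1"
        unfolding count_prob_eq using True by (simp add: fejer_def)
      then show ?thesis
        using pi8 by simp
    next
      case False
      then have "n + 1 < M"
        using n M_pos by linarith
      \<comment> \<open>The two neighbours share the numerator of the kernel bound, which brings
        their sum into the form of \<open>sin_pi_two_point_bound\<close>.\<close>
      have "sin (pi * (d - 1)) = - sin (pi * d)"
        by (simp add: right_diff_distrib sin_diff)
      then have sin_eq: "(sin (pi * (d - 1)))\<^sup>2 = (sin (pi * d))\<^sup>2"
        by simp
      have "8 / pi\<^sup>2 \<le> (sin (pi * d))\<^sup>2 * (1 / d\<^sup>2 + 1 / (1 - d)\<^sup>2) / pi\<^sup>2"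
        using d0 d by (intro divide_right_mono sin_pi_two_point_bound) auto
      also have "\<dots> = (sin (pi * d))\<^sup>2 / (pi\<^sup>2 * d\<^sup>2) + (sin (pi * (d - 1)))\<^sup>2 / (pi\<^sup>2 * (d - 1)\<^sup>2)"
        unfolding sin_eq power2_commute[of d 1] by (simp add: distrib_left add_divide_distrib mult.commute)
      also have "\<dots> \<le> fejer M d + fejer M (d - 1)"
        using d0 d M_pos by (intro add_mono fejer_lower) auto
      also have "\<dots> = (\<Sum>y\<in>{n, n + 1}. fejer M (omega - real y))"
        by (simp add: d_def algebra_simps)
      also have "\<dots> \<le> count_prob N f M P"
        unfolding count_prob_eq
        using \<open>n + 1 < M\<close> near[of n] near[of "n + 1"] d
        by (intro sum_mono2) (auto simp: fejer_nonneg d_def)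
      finally show ?thesis .
    qed
  qed
qed

section \<open>The cases with a certain output\<close>

lemma count_prob_none:
  assumes "t = 0"
  shows "count_prob N f M (\<lambda>t'. t' = 0) = 1"
  using M_pos assms
  by (intro count_prob_eq_1I[of 0]) (simp_all add: omega_def theta_def count_output_def)

text \<open>Here omega = M / 2, which is an outcome exactly because M is even.\<close>

lemma count_prob_all:
  assumes "t = N" "even M"
  shows "count_prob N f M (\<lambda>t'. t' = real N) = 1"
proof (rule count_prob_eq_1I[of "M div 2"])
  have half: "real (M div 2) = real M / 2"
    using assms(2) by (simp add: real_of_nat_div)
  have theta: "theta = pi / 2"
    using assms(1) N_pos by (simp add: theta_def)
  show "omega = real (M div 2)"
    by (simp add: omega_def half theta)
  have "pi * real (M div 2) / real M = pi / 2"
    using M_pos by (simp add: half)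
  then show "count_output N M (M div 2) = real N"
    unfolding count_output_def by (simp only: sin_pi_half) simp
qed (use M_pos in auto)

end

theorem theorem7:
  fixes N M k :: nat and f :: "nat \<Rightarrow> bool"
  assumes "N \<ge> 1" and "M \<ge> 1" and "k \<ge> 1"
  defines "t \<equiv> card {x. x < N \<and> f x}"
  defines "good \<equiv> (\<lambda>t'. \<bar>t' - real t\<bar> \<le>
      2 * pi * real k * sqrt (real t * real (N - t)) / real M
      + pi\<^sup>2 * (real k)\<^sup>2 * real N / (real M)\<^sup>2)"
  shows "(k = 1 \<longrightarrow> count_prob N f M good \<ge> 8 / pi\<^sup>2)
       \<and> (k \<ge> 2 \<longrightarrow> count_prob N f M good > 1 - 1 / (2 * (real k - 1)))
       \<and> (t = 0 \<longrightarrow> count_prob N f M (\<lambda>t'. t' = 0) = 1)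
       \<and> (t = N \<and> even M \<longrightarrow> count_prob N f M (\<lambda>t'. t' = real N) = 1)"
proof -
  interpret qc: quantum_counting N M f
    using assms(1,2) by unfold_locales
  have t: "t = qc.t"
    by (simp only: t_def qc.t_def)
  have near: "good (count_output N M y)" if "s = 0 \<or> s = real M" "\<bar>qc.omega - real y + s\<bar> \<le> real k" for y s
    unfolding good_def t by (rule qc.count_output_near[OF that])
  show ?thesis
    using qc.count_prob_good_ge[of good] near[of 0] qc.count_prob_good_gt[of k good, OF _ near]
      qc.count_prob_none qc.count_prob_all
    by (auto simp: t)
qed

end
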